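(* Let $n\ge 2$ and $M\in\mathcal{M}_n$. If $n$ is odd, then the number of centered flips applicable to $M$ equals the number of visible edges of $M$. If $n$ is even, then the number of centered flips applicable to $M$ is at most the number of visible edges of $M$ and at least half the number of visible edges of $M$, and both of these bounds are tight (there are matchings attaining the upper bound with equality, and matchings attaining the lower bound with equality).
   Context: Fix an integer $n\ge 2$ and place $2n$ points equidistantly on the unit circle. $\mathcal{M}_n$ is the set of all non-crossing straight-line perfect matchings on these $2n$ points (each has $n$ edges). For $M\in\mathcal{M}_n$, two edges $e,f\in M$ span an empty quadrilateral if the convex hull of $e$ and $f$ contains no other edge of $M$; replacing $e,f$ by the other two edges of this quadrilateral yields another matching of $\mathcal{M}_n$, and this operation is called a flip. A flip is centered if the closed quadrilateral contains the center of the circle (the center may lie on its boundary). An edge $e\in M$ is visible if the two rays from the circle center to the endpoints of $e$ cross no other edge of $M$; if $n$ is odd and $M$ has an edge passing through the center, this edge is ignored when deciding visibility of the other edges, and the edge through the center is itself declared not visible.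
   Formalization: Tightness of the upper bound is claimed only for even n ≥ 6: for n = 2 and n = 4 no matching has as many centered flips as visible edges, so for those n the claim fails; the lower bound is shown tight for every even n ≥ 2. *)

theory Defs
  imports "HOL-Analysis.Analysis"
begin

text \<open>
  The circle is the unit circle of the complex plane with centre \<open>0\<close>. An edge is represented by
  the set of its two endpoints; the straight-line segment it stands for is its convex hull.
\<close>

definition circle_points :: "nat \<Rightarrow> complex set" where
  "circle_points n = (\<lambda>k. cis (2 * pi * real k / real (2 * n))) ` {..<2 * n}"

definition nc_matchings :: "nat \<Rightarrow> complex set set set" where
  "nc_matchings n = {M. partition_on (circle_points n) M \<and> (\<forall>e\<in>M. card e = 2) \<and>
     pairwise (\<lambda>e f. convex hull e \<inter> convex hull f = {}) M}"

text \<open>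
  As the points are in convex position, no other edge of the matching can be a subset of the
  quadrilateral; the quadrilateral is empty if no other edge has a point in it.
\<close>

definition empty_quad :: "complex set set \<Rightarrow> complex set \<Rightarrow> complex set \<Rightarrow> bool" where
  "empty_quad M e f \<longleftrightarrow> e \<in> M \<and> f \<in> M \<and> e \<noteq> f \<and>
     (\<forall>g\<in>M - {e, f}. convex hull (e \<union> f) \<inter> convex hull g = {})"

definition quad_sides :: "complex set \<Rightarrow> complex set \<Rightarrow> complex set set" where
  "quad_sides e f = {g. g \<subseteq> e \<union> f \<and> card g = 2 \<and> (convex hull g) edge_of (convex hull (e \<union> f))}"

definition flip :: "complex set set \<Rightarrow> complex set \<Rightarrow> complex set \<Rightarrow> complex set set" where
  "flip M e f = (M - {e, f}) \<union> (quad_sides e f - {e, f})"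

text \<open>
  A flip applicable to \<open>M\<close> is identified with the matching it produces; the unordered pair of
  edges it replaces can be recovered as the set of edges of \<open>M\<close> missing from the result.
\<close>

definition centered_flips :: "complex set set \<Rightarrow> complex set set set" where
  "centered_flips M = {flip M e f | e f. empty_quad M e f \<and> 0 \<in> convex hull (e \<union> f)}"

text \<open>
  The part of a ray beyond the endpoint of the edge lies outside the closed disc, so only the
  segment from the centre to the endpoint matters. An edge through the centre occurs only for
  odd \<open>n\<close>, so the conditions \<open>0 \<notin> convex hull _\<close> have no effect for even \<open>n\<close>.
\<close>

definition visible_edges :: "complex set set \<Rightarrow> complex set set" where
  "visible_edges M = {e \<in> M. 0 \<notin> convex hull e \<and>
     (\<forall>p\<in>e. \<forall>g\<in>M - {e}. 0 \<notin> convex hull g \<longrightarrow> closed_segment 0 p \<inter> convex hull g = {})}"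

end

theory Submission
  imports Defs
begin

text \<open>
  Call the endpoint \<open>s\<close> of an edge \<open>{s, t}\<close> its start if the short arc from \<open>s\<close> to \<open>t\<close> runs
  counterclockwise, and say that an edge shadows the points of its closed short arc. If no edge
  passes through the centre, every point is shadowed by exactly one visible edge. Assign to a
  visible edge \<open>e\<close> the pair \<open>{e, f}\<close>, where \<open>f\<close> is the visible edge shadowing the antipode of the
  start of \<open>e\<close>. Any two visible edges span an empty quadrilateral, and a quadrilateral \<open>{e, f}\<close>
  contains the centre iff the two closed arcs contain antipodal points; rotating such a pair of
  points clockwise until one of them is a start shows that the assignment is onto the centered
  flips. Clearly \<open>{e, f}\<close> has at most the preimages \<open>e\<close> and \<open>f\<close>, and both occur only if their starts
  are antipodal. In that case the \<open>n - 1\<close> points of the open half circle between the two starts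
  are matched among themselves except for one, so \<open>n\<close> is even. The same count shows that an edge
  through the centre forces \<open>n\<close> to be odd; the centered flips are then the pairs of this edge with
  a visible edge.
\<close>

subsection \<open>Chords of the unit circle\<close>

text \<open>For nonzero vectors the sign encodes orientation: it is positive iff a counterclockwise
  turn strictly between 0 and \<open>pi\<close> leads from \<open>z\<close> to
  \<open>w\<close>.\<close>

definition cross2 :: "complex \<Rightarrow> complex \<Rightarrow> real" where
  "cross2 z w = Re z * Im w - Im z * Re w"

lemma cross2_commute: "cross2 z w = - cross2 w z"
  by (simp add: cross2_def)

lemma cross2_simps [simp]:
  "cross2 z z = 0" "cross2 z 0 = 0" "cross2 0 z = 0"
  "cross2 (- z) w = - cross2 z w" "cross2 z (- w) = - cross2 z w"
  "cross2 (z + v) w = cross2 z w + cross2 v w" "cross2 z (w + v) = cross2 z w + cross2 z v"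
  "cross2 (a *\<^sub>R z) w = a * cross2 z w" "cross2 z (a *\<^sub>R w) = a * cross2 z w"
  by (simp_all add: cross2_def algebra_simps)

text \<open>Lagrange's identity in the plane.\<close>

lemma cross2_power2_add_inner_power2:
  "(cross2 p q)\<^sup>2 + (p \<bullet> q)\<^sup>2 = (norm p)\<^sup>2 * (norm q)\<^sup>2"
  unfolding cross2_def inner_complex_def cmod_power2 by algebra

text \<open>Cramer's rule.\<close>

lemma cross2_basis:
  assumes "cross2 p q \<noteq> 0"
  shows "w = (cross2 w q / cross2 p q) *\<^sub>R p + (cross2 p w / cross2 p q) *\<^sub>R q"
proof -
  have "cross2 p q *\<^sub>R w = cross2 w q *\<^sub>R p + cross2 p w *\<^sub>R q"
    by (simp add: complex_eq_iff cross2_def algebra_simps)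
  then have "w = (1 / cross2 p q) *\<^sub>R (cross2 w q *\<^sub>R p + cross2 p w *\<^sub>R q)"
    using assms by (metis (no_types) divide_self_if scaleR_one scaleR_scaleR times_divide_eq_left mult_1)
  then show ?thesis by (simp add: scaleR_add_right)
qed

text \<open>Lagrange's identity makes the inner product 1 or -1, and then \<open>q - p\<close> or
  \<open>q + p\<close> has norm 0.\<close>

lemma cross2_eq_0_unit:
  assumes "norm p = 1" "norm q = 1" "cross2 p q = 0"
  shows "q = p \<or> q = - p"
proof -
  have "(p \<bullet> q)\<^sup>2 = 1"
    using cross2_power2_add_inner_power2[of p q] assms by simp
  then have "p \<bullet> q = 1 \<or> p \<bullet> q = - 1"
    by (simp add: power2_eq_1_iff)
  moreover have "(norm (q - p))\<^sup>2 = 2 - 2 * (p \<bullet> q)" "(norm (q + p))\<^sup>2 = 2 + 2 * (p \<bullet> q)"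
    using assms by (simp_all add: power2_norm_eq_inner inner_diff inner_add inner_commute norm_eq_1)
  ultimately have "norm (q - p) = 0 \<or> norm (q + p) = 0"
    by auto
  then show ?thesis
    by (auto simp: add_eq_0_iff)
qed

text \<open>The chord lies on the line \<open>(p + q) \<bullet> w = 1 + p \<bullet> q\<close>; if
  this contained 0, then \<open>norm (q + p)\<close> would be 0.\<close>

lemma centre_notin_hull:
  fixes p q :: complex
  assumes "norm p = 1" "norm q = 1" "q \<noteq> - p"
  shows "0 \<notin> convex hull {p, q}"
proof
  assume z: "0 \<in> convex hull {p, q}"
  have self: "p \<bullet> p = 1" "q \<bullet> q = 1" using assms by (simp_all add: norm_eq_1)
  have "convex hull {p, q} \<subseteq> {w. (p + q) \<bullet> w = 1 + p \<bullet> q}"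
    using self by (intro hull_minimal convex_hyperplane) (auto simp: inner_add_left inner_commute[of q p])
  then have "1 + p \<bullet> q = 0" using z by auto
  moreover have "(norm (q + p))\<^sup>2 = 2 * (1 + p \<bullet> q)"
    unfolding power2_norm_eq_inner using self by (simp add: inner_add inner_commute)
  ultimately show False using assms(3) by (simp add: add_eq_0_iff2)
qed

text \<open>\<open>p + q\<close> is a normal vector of the chord, which lies on the line \<open>(p + q) \<bullet> w = 1 + p \<bullet> q\<close>.\<close>

locale chord =
  fixes p q :: complex
  assumes norm_p: "norm p = 1" and norm_q: "norm q = 1"
    and distinct: "p \<noteq> q" and centre: "0 \<notin> convex hull {p, q}"
begin

lemma swap: "chord q p"
  using norm_p norm_q distinct centre by unfold_locales (auto simp: insert_commute)

lemma inner_self: "p \<bullet> p = 1" "q \<bullet> q = 1"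
  using norm_p norm_q by (simp_all add: norm_eq_1)

lemma not_antipodal: "q \<noteq> - p"
proof
  assume "q = - p"
  then have "0 \<in> closed_segment p q"
    by (auto simp: in_segment intro!: exI[of _ "1/2"])
  then show False using centre by (simp add: segment_convex_hull)
qed

lemma cross2_neq_0: "cross2 p q \<noteq> 0"
  using cross2_eq_0_unit[OF norm_p norm_q] distinct not_antipodal by auto

lemma inner_bounds: "- 1 < p \<bullet> q" "p \<bullet> q < 1"
proof -
  have "(cross2 p q)\<^sup>2 > 0" using cross2_neq_0 by simp
  then have "(p \<bullet> q)\<^sup>2 < 1"
    using cross2_power2_add_inner_power2[of p q] unfolding norm_p norm_q power_one by linarith
  then show "- 1 < p \<bullet> q" "p \<bullet> q < 1"
    by (simp_all add: abs_square_less_1 abs_less_iff)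
qed

lemma inner_comb:
  "(p + q) \<bullet> (a *\<^sub>R p + b *\<^sub>R q) = (a + b) * (1 + p \<bullet> q)"
  by (simp add: inner_add inner_self inner_commute[of q p] algebra_simps)

lemma inner_on_hull: "w \<in> convex hull {p, q} \<Longrightarrow> (p + q) \<bullet> w = 1 + p \<bullet> q"
  unfolding segment_convex_hull[symmetric] by (auto simp: in_segment inner_comb)

text \<open>In the basis \<open>p\<close>, \<open>q\<close> the coordinates \<open>a\<close>,
  \<open>b\<close> of \<open>w\<close> sum to 1. Comparing the norm bound with
  \<open>(a + b)\<^sup>2 = 1\<close> leaves \<open>a * b * (1 - p \<bullet> q) \<ge> 0\<close>, so
  neither coordinate is negative.\<close>

lemma hull_if_on_line:
  assumes "norm w \<le> 1" "(p + q) \<bullet> w = 1 + p \<bullet> q"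
  shows "w \<in> convex hull {p, q}"
proof -
  obtain a b where w: "w = a *\<^sub>R p + b *\<^sub>R q"
    using cross2_basis[OF cross2_neq_0, of w] by blast
  have ab: "a + b = 1"
    using assms(2) inner_bounds unfolding w inner_comb by simp
  have "(norm w)\<^sup>2 \<le> 1"
    using assms(1) by (simp add: power_le_one)
  moreover have "(norm w)\<^sup>2 = a * a + b * b + 2 * (a * b) * (p \<bullet> q)"
    unfolding w power2_norm_eq_inner
    by (simp add: inner_add inner_self inner_commute[of q p] algebra_simps)
  moreover have "1 = a * a + b * b + 2 * (a * b)"
    using arg_cong[OF ab, of "\<lambda>x. x * x"] by (simp add: algebra_simps)
  ultimately have "0 \<le> a * b * (1 - p \<bullet> q)" by (simp add: algebra_simps)
  then have "0 \<le> a * b" using inner_bounds by (simp add: zero_le_mult_iff)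
  then have "0 \<le> a" "0 \<le> b" using ab by (auto simp: zero_le_mult_iff)
  then have "w \<in> closed_segment p q"
    unfolding in_segment using ab w by (intro exI[of _ b]) auto
  then show ?thesis by (simp add: segment_convex_hull)
qed

end

lemma chord_if_cross2_pos:
  assumes "norm p = 1" "norm q = 1" "cross2 p q > 0"
  shows "chord p q"
proof
  show "p \<noteq> q" using assms by auto
  have "q \<noteq> - p" using assms by auto
  then show "0 \<notin> convex hull {p, q}" using assms centre_notin_hull by blast
qed (use assms in auto)

section \<open>Shadows of a chord\<close>

definition shadows :: "complex set \<Rightarrow> complex \<Rightarrow> bool" where
  "shadows e z \<longleftrightarrow> closed_segment 0 z \<inter> convex hull e \<noteq> {}"

context chord
begin

lemma shadows_imp_cone:
  assumes "shadows {p, q} z"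
  obtains a b where "z = a *\<^sub>R p + b *\<^sub>R q" "a \<ge> 0" "b \<ge> 0"
proof -
  obtain t l where t: "0 \<le> t" "t \<le> 1" and l: "0 \<le> l" "l \<le> 1"
    and eq: "t *\<^sub>R z = (1 - l) *\<^sub>R p + l *\<^sub>R q"
    using assms unfolding shadows_def segment_convex_hull[symmetric]
    by (auto simp: in_segment)
  \<comment> \<open>With \<open>t = 0\<close> the chord would pass through the centre; hence the
    common point can be rescaled to \<open>z\<close>.\<close>
  have "t \<noteq> 0"
  proof
    assume "t = 0"
    with eq l have "0 \<in> closed_segment p q" by (auto simp: in_segment)
    then show False using centre by (simp add: segment_convex_hull)
  qed
  then have "z = (1 / t) *\<^sub>R (t *\<^sub>R z)" by simp
  also have "\<dots> = ((1 - l) / t) *\<^sub>R p + (l / t) *\<^sub>R q"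
    unfolding eq by (simp add: scaleR_add_right)
  finally show ?thesis using that l t by simp
qed

text \<open>For a unit vector the triangle inequality gives \<open>a + b \<ge> 1\<close>, and
  \<open>inner_comb\<close> turns this sum into the position relative to the line.\<close>

lemma inner_le_if_cone:
  assumes "norm z = 1" "z = a *\<^sub>R p + b *\<^sub>R q" "a \<ge> 0" "b \<ge> 0"
  shows "1 + p \<bullet> q \<le> (p + q) \<bullet> z"
proof -
  have "1 \<le> norm (a *\<^sub>R p) + norm (b *\<^sub>R q)"
    using assms(1,2) norm_triangle_ineq by metis
  then have "1 \<le> a + b" using assms norm_p norm_q by simp
  then show ?thesis
    unfolding assms(2) inner_comb using inner_bounds mult_right_mono[of 1 "a + b"] by fastforce
qed

lemma shadows_if_inner_le:
  assumes "norm z = 1" "1 + p \<bullet> q \<le> (p + q) \<bullet> z"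
  shows "shadows {p, q} z"
proof -
  \<comment> \<open>The factor that moves \<open>z\<close> along its ray onto the line of the
    chord.\<close>
  define t where "t = (1 + p \<bullet> q) / ((p + q) \<bullet> z)"
  have pos: "0 < (p + q) \<bullet> z" using assms inner_bounds by linarith
  have t: "0 \<le> t" "t \<le> 1"
    using assms pos inner_bounds unfolding t_def by auto
  have t_def_eq: "t * ((p + q) \<bullet> z) = 1 + p \<bullet> q" using pos by (simp add: t_def)
  have "t *\<^sub>R z \<in> convex hull {p, q}"
    using t assms(1) t_def_eq by (intro hull_if_on_line) simp_all
  moreover have "t *\<^sub>R z \<in> closed_segment 0 z"
    using t by (auto simp: in_segment)
  ultimately show ?thesis unfolding shadows_def by blast
qed

text \<open>Shadow, cone and half plane imply one another in a cycle; this linear test replaces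
  intersections of segments in later arguments.\<close>

lemma shadows_iff_inner:
  "norm z = 1 \<Longrightarrow> shadows {p, q} z \<longleftrightarrow> 1 + p \<bullet> q \<le> (p + q) \<bullet> z"
  using shadows_imp_cone inner_le_if_cone shadows_if_inner_le by metis

lemma shadows_if_cone:
  "norm z = 1 \<Longrightarrow> z = a *\<^sub>R p + b *\<^sub>R q \<Longrightarrow> a \<ge> 0 \<Longrightarrow> b \<ge> 0 \<Longrightarrow> shadows {p, q} z"
  using inner_le_if_cone shadows_if_inner_le by blast

text \<open>Otherwise the segment from \<open>r\<close> to \<open>s\<close> meets the line by the
  intermediate value theorem. The meeting point is in the unit disc, so by
  \<open>hull_if_on_line\<close> it belongs to the chord.\<close>

lemma same_side:
  assumes "norm r = 1" "norm s = 1" "convex hull {p, q} \<inter> convex hull {r, s} = {}"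
  shows "((p + q) \<bullet> r < 1 + p \<bullet> q \<and> (p + q) \<bullet> s < 1 + p \<bullet> q) \<or>
         ((p + q) \<bullet> r > 1 + p \<bullet> q \<and> (p + q) \<bullet> s > 1 + p \<bullet> q)"
proof (rule ccontr)
  assume neg: "\<not> ?thesis"
  define c where "c = 1 + p \<bullet> q"
  have "connected (convex hull {r, s})" by (simp add: convex_connected)
  moreover have "r \<in> convex hull {r, s}" "s \<in> convex hull {r, s}"
    by (simp_all add: hull_inc)
  ultimately have "\<exists>w \<in> convex hull {r, s}. (p + q) \<bullet> w = c"
    using neg connected_ivt_hyperplane[of "convex hull {r, s}" r s "p + q" c]
      connected_ivt_hyperplane[of "convex hull {r, s}" s r "p + q" c]
    unfolding c_def[symmetric] by linarith
  then obtain w where w: "w \<in> convex hull {r, s}" "(p + q) \<bullet> w = c" by blast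
  have "convex hull {r, s} \<subseteq> cball 0 1"
    using assms by (intro hull_minimal) (auto simp: convex_cball)
  then have "norm w \<le> 1" using w by auto
  then have "w \<in> convex hull {p, q}"
    using w hull_if_on_line c_def by blast
  then show False using assms w by blast
qed

end

text \<open>Two planar cones with a common nonzero vector \<open>z\<close>: rotating \<open>z\<close> clockwise, the first ray
  reached is the initial ray of one of them and still lies in the other.\<close>

lemma initial_ray_in_other_cone:
  assumes "cross2 s t > 0" "cross2 s' t' > 0"
    and "z = a *\<^sub>R s + b *\<^sub>R t" "z = a' *\<^sub>R s' + b' *\<^sub>R t'" "z \<noteq> 0"
    and "a \<ge> 0" "b \<ge> 0" "a' \<ge> 0" "b' \<ge> 0"
  shows "(\<exists>x y. x \<ge> 0 \<and> y \<ge> 0 \<and> s = x *\<^sub>R s' + y *\<^sub>R t') \<or>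
         (\<exists>x y. x \<ge> 0 \<and> y \<ge> 0 \<and> s' = x *\<^sub>R s + y *\<^sub>R t)"
proof -
  \<comment> \<open>This covers the case that \<open>s'\<close> is not clockwise of
    \<open>s\<close>; the other case follows by exchanging the cones.\<close>
  have step: "(\<exists>x y. x \<ge> 0 \<and> y \<ge> 0 \<and> s = x *\<^sub>R s' + y *\<^sub>R t') \<or>
         (\<exists>x y. x \<ge> 0 \<and> y \<ge> 0 \<and> s' = x *\<^sub>R s + y *\<^sub>R t)"
    if c: "cross2 s s' \<ge> 0" and st: "cross2 s t > 0" and st': "cross2 s' t' > 0"
    and z: "z = a *\<^sub>R s + b *\<^sub>R t" "z = a' *\<^sub>R s' + b' *\<^sub>R t'" "z \<noteq> 0"
    and ge: "a \<ge> 0" "b \<ge> 0" "a' \<ge> 0" "b' \<ge> 0" for s t s' t' a b a' b'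
  proof (cases "b = 0")
    case True
    \<comment> \<open>Here \<open>z\<close> is a positive multiple of \<open>s\<close>, so
      \<open>s\<close> itself lies in the other cone.\<close>
    then have "a > 0" using z ge by (cases "a = 0") auto
    have as: "a *\<^sub>R s = a' *\<^sub>R s' + b' *\<^sub>R t'" using z True by simp
    have "s = (1 / a) *\<^sub>R (a *\<^sub>R s)" using \<open>a > 0\<close> by simp
    also have "\<dots> = (a' / a) *\<^sub>R s' + (b' / a) *\<^sub>R t'"
      unfolding as by (simp add: scaleR_add_right)
    finally have "s = (a' / a) *\<^sub>R s' + (b' / a) *\<^sub>R t'" .
    moreover have "a' / a \<ge> 0" "b' / a \<ge> 0" using ge \<open>a > 0\<close> by simp_all
    ultimately show ?thesis by blast
  next
    case False
    \<comment> \<open>As \<open>z\<close> is not clockwise of \<open>s'\<close>, neither is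
      \<open>t\<close>; together with \<open>cross2 s s' \<ge> 0\<close> this places
      \<open>s'\<close> in the cone of \<open>s\<close> and \<open>t\<close>.\<close>
    have "cross2 s' z = b' * cross2 s' t'" unfolding z(2) by simp
    then have "0 \<le> cross2 s' z" using ge st' by simp
    also have "cross2 s' z = - a * cross2 s s' + b * cross2 s' t"
      unfolding z(1) by (simp add: cross2_commute[of s'])
    finally have "0 \<le> b * cross2 s' t"
      using mult_nonneg_nonneg[OF ge(1) c] by linarith
    then have "0 \<le> cross2 s' t" using False ge by (simp add: zero_le_mult_iff)
    then have "cross2 s' t / cross2 s t \<ge> 0" "cross2 s s' / cross2 s t \<ge> 0"
      using st c by simp_all
    then show ?thesis using cross2_basis[of s t s'] st by (metis less_irrefl)
  qed
  show ?thesis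
  proof (cases "cross2 s s' \<ge> 0")
    case True
    then show ?thesis using step[OF _ assms(1,2,3,4,5)] assms by blast
  next
    case False
    then have "cross2 s' s \<ge> 0" using cross2_commute[of s s'] by simp
    then show ?thesis using step[OF _ assms(2,1,4,3,5)] assms by blast
  qed
qed

subsection \<open>Non-crossing matchings\<close>

text \<open>The pairs replaced by centered flips, counted in place of the matchings produced (see
  \<open>card_centered_flips\<close>).\<close>

definition centered_pairs :: "complex set set \<Rightarrow> complex set set set" where
  "centered_pairs M = {{e, f} | e f. empty_quad M e f \<and> 0 \<in> convex hull (e \<union> f)}"

definition half_circle :: "complex set \<Rightarrow> complex \<Rightarrow> complex set" where
  "half_circle P p = {z \<in> P. cross2 p z > 0}"

text \<open>\<open>cross2 p\<close> changes sign along the chord, so the chord meets the line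
  through \<open>p\<close> and \<open>- p\<close>, and within the disc it can do so only on the
  diameter.\<close>

lemma chord_meets_diameter:
  assumes "norm p = 1" "norm r = 1" "norm s = 1" "cross2 p r > 0" "cross2 p s < 0"
  obtains w where "w \<in> convex hull {r, s}" "w \<in> closed_segment 0 p \<or> w \<in> closed_segment 0 (- p)"
proof -
  \<comment> \<open>\<open>\<i> * p\<close> is \<open>p\<close> turned by a right angle; this
    presents \<open>cross2 p\<close> as an inner product, the form the hyperplane argument
    needs.\<close>
  have cross: "(\<i> * p) \<bullet> w = cross2 p w" for w
    by (simp add: inner_complex_def cross2_def)
  have "connected (convex hull {r, s})" by (simp add: convex_connected)
  moreover have "r \<in> convex hull {r, s}" "s \<in> convex hull {r, s}"
    by (simp_all add: hull_inc)
  ultimately obtain w where w: "w \<in> convex hull {r, s}" "cross2 p w = 0"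
    using connected_ivt_hyperplane[of "convex hull {r, s}" s r "\<i> * p" 0] assms
    unfolding cross by auto
  have "convex hull {r, s} \<subseteq> cball 0 1"
    using assms by (intro hull_minimal) (auto simp: convex_cball)
  then have nw: "norm w \<le> 1" using w by auto
  define l where "l = p \<bullet> w"
  have "Re p * Re p + Im p * Im p = 1"
    using assms(1) by (simp add: norm_eq_1 inner_complex_def)
  then have "Re w = l * Re p" "Im w = l * Im p"
    using w(2) unfolding l_def inner_complex_def inner_real_def cross2_def by algebra+
  then have wl: "w = l *\<^sub>R p"
    by (simp add: complex_eq_iff)
  then have "\<bar>l\<bar> \<le> 1" using nw assms(1) by simp
  then have "w \<in> closed_segment 0 p \<or> w \<in> closed_segment 0 (- p)"
    unfolding in_segment wl
    by (cases "l \<ge> 0") (auto intro: exI[of _ l] exI[of _ "- l"])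
  with w that show ?thesis by blast
qed

text \<open>The point set is kept abstract. Closure under antipodes makes the antipode of a start a
  point of the matching again.\<close>

locale circle_matching =
  fixes P :: "complex set" and M :: "complex set set"
  assumes finite_P: "finite P"
    and norm_P: "z \<in> P \<Longrightarrow> norm z = 1"
    and uminus_P: "z \<in> P \<Longrightarrow> - z \<in> P"
    and partition: "partition_on P M"
    and card_edge: "e \<in> M \<Longrightarrow> card e = 2"
    and hull_disjoint: "e \<in> M \<Longrightarrow> f \<in> M \<Longrightarrow> e \<noteq> f \<Longrightarrow> convex hull e \<inter> convex hull f = {}"
begin

lemma finite_M: "finite M"
  using finite_P partition by (rule finite_elements)

lemma edge_disjoint: "e \<in> M \<Longrightarrow> f \<in> M \<Longrightarrow> x \<in> e \<Longrightarrow> x \<in> f \<Longrightarrow> e = f"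
  using hull_disjoint hull_inc by (metis IntI empty_iff)

lemma in_P: "e \<in> M \<Longrightarrow> x \<in> e \<Longrightarrow> x \<in> P"
  using partition partition_onD1 by blast

lemma norm_edge: "e \<in> M \<Longrightarrow> x \<in> e \<Longrightarrow> norm x = 1"
  using in_P norm_P by blast

lemma edge_of_point: "z \<in> P \<Longrightarrow> \<exists>e\<in>M. z \<in> e"
  using partition partition_onD1 by blast

lemma oriented_edge:
  assumes "e \<in> M" "0 \<notin> convex hull e"
  obtains s t where "e = {s, t}" "cross2 s t > 0" "chord s t"
proof -
  obtain p q where e: "e = {p, q}" "p \<noteq> q"
    using card_edge[OF assms(1)] by (auto simp: card_2_iff)
  interpret chord p q
    using assms e norm_edge[OF assms(1)] by unfold_locales auto
  show ?thesis
  proof (cases "cross2 p q > 0")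
    case True
    then show ?thesis using that e chord_axioms by blast
  next
    case False
    then have "cross2 q p > 0" using cross2_neq_0 cross2_commute[of q p] by simp
    then show ?thesis using that[of q p] e swap by (simp add: insert_commute)
  qed
qed

section \<open>Visibility in terms of shadows\<close>

lemma visible_edges_iff:
  "e \<in> visible_edges M \<longleftrightarrow> e \<in> M \<and> 0 \<notin> convex hull e \<and>
     (\<forall>x\<in>e. \<forall>g\<in>M. g \<noteq> e \<longrightarrow> 0 \<notin> convex hull g \<longrightarrow> \<not> shadows g x)"
  unfolding visible_edges_def shadows_def by blast

text \<open>Unit vectors not shadowed by \<open>g\<close> lie in the open half plane on the centre's
  side of \<open>g\<close>, which is convex and misses \<open>g\<close>.\<close>

lemma hull_disjoint_if_not_shadowed:
  assumes "g \<in> M" "0 \<notin> convex hull g" "\<And>x. x \<in> X \<Longrightarrow> norm x = 1 \<and> \<not> shadows g x"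
  shows "convex hull X \<inter> convex hull g = {}"
proof -
  obtain p q where g: "g = {p, q}" and "chord p q"
    using oriented_edge assms(1,2) by metis
  interpret chord p q by fact
  have "convex hull X \<subseteq> {x. (p + q) \<bullet> x < 1 + p \<bullet> q}"
    using assms(3) shadows_iff_inner g
    by (intro hull_minimal convex_halfspace_lt) (metis mem_Collect_eq not_le subsetI)
  then show ?thesis using inner_on_hull g by fastforce
qed

text \<open>The shadowed endpoint is on or beyond the line of \<open>{p, q}\<close>; as the edges do
  not cross, \<open>same_side\<close> puts both endpoints strictly beyond it.\<close>

lemma shadowed_edge_beyond:
  assumes "{p, q} \<in> M" "chord p q" "e \<in> M" "e \<noteq> {p, q}" "x \<in> e" "shadows {p, q} x"
    and "w \<in> convex hull e"
  shows "(p + q) \<bullet> w > 1 + p \<bullet> q"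
proof -
  interpret chord p q by fact
  obtain y where e: "e = {x, y}"
    using card_edge[OF assms(3)] assms(5) by (auto simp: card_2_iff)
  have "1 + p \<bullet> q \<le> (p + q) \<bullet> x"
    using assms(3,5,6) shadows_iff_inner norm_edge by blast
  then have "(p + q) \<bullet> x > 1 + p \<bullet> q \<and> (p + q) \<bullet> y > 1 + p \<bullet> q"
    using same_side[of x y] hull_disjoint[OF assms(1,3)] assms(4) norm_edge[OF assms(3)] e by auto
  then have "convex hull e \<subseteq> {w. (p + q) \<bullet> w > 1 + p \<bullet> q}"
    unfolding e by (intro hull_minimal convex_halfspace_gt) auto
  then show ?thesis using assms(7) by blast
qed

lemma visible_before:
  assumes "{p, q} \<in> M" "chord p q" "e \<in> visible_edges M" "e \<noteq> {p, q}" "w \<in> convex hull e"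
  shows "(p + q) \<bullet> w < 1 + p \<bullet> q"
proof -
  interpret chord p q by fact
  have "\<not> shadows {p, q} x \<and> norm x = 1" if "x \<in> e" for x
    using assms(1,3,4) norm_edge centre that unfolding visible_edges_iff by metis
  then have "e \<subseteq> {x. (p + q) \<bullet> x < 1 + p \<bullet> q}"
    using shadows_iff_inner not_le by blast
  then have "convex hull e \<subseteq> {x. (p + q) \<bullet> x < 1 + p \<bullet> q}"
    by (intro hull_minimal convex_halfspace_lt)
  then show ?thesis using assms(5) by blast
qed

text \<open>Of two edges met by the ray to \<open>z\<close>, the later one has a point on or beyond
  the line of the earlier one, which \<open>visible_before\<close> rules out.\<close>

lemma visible_shadows_disjoint:
  assumes "e \<in> visible_edges M" "f \<in> visible_edges M" "shadows e z" "shadows f z"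
  shows "e = f"
proof -
  have le: "e = f" if e: "e \<in> visible_edges M" and f: "f \<in> visible_edges M"
    and t: "t *\<^sub>R z \<in> convex hull e" "t' *\<^sub>R z \<in> convex hull f" "0 \<le> t" "t \<le> t'" for e f t t'
  proof (rule ccontr)
    assume "e \<noteq> f"
    have eM: "e \<in> M" "0 \<notin> convex hull e" using e visible_edges_iff by auto
    obtain p q where pq: "e = {p, q}" and "chord p q" using oriented_edge[OF eM] by metis
    interpret chord p q by fact
    have "t * ((p + q) \<bullet> z) = 1 + p \<bullet> q"
      using inner_on_hull t(1) pq by fastforce
    moreover have "t' * ((p + q) \<bullet> z) < 1 + p \<bullet> q"
      using visible_before[OF _ \<open>chord p q\<close> f _ t(2)] eM pq \<open>e \<noteq> f\<close> by auto
    moreover have "(p + q) \<bullet> z > 0"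
      using calculation(1) inner_bounds t(3) by (smt (verit) mult_nonneg_nonpos)
    ultimately show False using mult_right_mono[OF t(4), of "(p + q) \<bullet> z"] by linarith
  qed
  obtain t t' where "t *\<^sub>R z \<in> convex hull e" "t' *\<^sub>R z \<in> convex hull f" "0 \<le> t" "0 \<le> t'"
    using assms(3,4) unfolding shadows_def by (auto simp: in_segment)
  then show ?thesis using le[OF assms(1,2)] le[OF assms(2,1)] by (metis linear)
qed

section \<open>From flips to pairs of edges\<close>

text \<open>Removing the new matching from \<open>M\<close> returns the replaced pair: a new side
  shares an endpoint with \<open>e\<close> or \<open>f\<close>, so it cannot be another edge of
  \<open>M\<close>.\<close>

lemma card_centered_flips: "card (centered_flips M) = card (centered_pairs M)"
proof (rule bij_betw_same_card[of "\<lambda>N. M - N"])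
  have diff: "M - flip M e f = {e, f}" if "empty_quad M e f" for e f
  proof -
    have "g \<notin> M" if g: "g \<in> quad_sides e f - {e, f}" for g
    proof
      assume "g \<in> M"
      have "g \<noteq> {}" using g by (auto simp: quad_sides_def)
      then obtain x where "x \<in> g" "x \<in> e \<union> f" using g by (auto simp: quad_sides_def)
      then have "g = e \<or> g = f"
        using edge_disjoint[OF \<open>g \<in> M\<close>] \<open>empty_quad M e f\<close> by (auto simp: empty_quad_def)
      then show False using g by blast
    qed
    then show ?thesis using that unfolding flip_def empty_quad_def by blast
  qed
  have sym: "flip M e f = flip M e' f'" if "{e, f} = {e', f'}" for e f e' f'
  proof -
    have "flip M e f = flip M f e"
      by (simp add: flip_def quad_sides_def Un_commute insert_commute)
    then show ?thesis using that unfolding doubleton_eq_iff by metis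
  qed
  show "bij_betw (\<lambda>N. M - N) (centered_flips M) (centered_pairs M)"
    unfolding bij_betw_def
  proof
    show "inj_on (\<lambda>N. M - N) (centered_flips M)"
    proof (rule inj_onI)
      fix N N' assume "N \<in> centered_flips M" "N' \<in> centered_flips M" and eq: "M - N = M - N'"
      then obtain e f e' f' where N: "N = flip M e f" "N' = flip M e' f'"
        and emp: "empty_quad M e f" "empty_quad M e' f'"
        unfolding centered_flips_def by blast
      then have "{e, f} = {e', f'}" using eq diff by simp
      then show "N = N'" unfolding N by (rule sym)
    qed
    show "(\<lambda>N. M - N) ` centered_flips M = centered_pairs M"
    proof (intro equalityI subsetI)
      fix X assume "X \<in> (\<lambda>N. M - N) ` centered_flips M"
      then obtain e f where X: "X = M - flip M e f"
        and ef: "empty_quad M e f" "0 \<in> convex hull (e \<union> f)"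
        unfolding centered_flips_def by blast
      have "X = {e, f}" using X diff[OF ef(1)] by simp
      then show "X \<in> centered_pairs M" using ef unfolding centered_pairs_def by blast
    next
      fix X assume "X \<in> centered_pairs M"
      then obtain e f where "X = {e, f}" and ef: "empty_quad M e f" "0 \<in> convex hull (e \<union> f)"
        unfolding centered_pairs_def by blast
      then have "X = M - flip M e f" using diff by simp
      moreover have "flip M e f \<in> centered_flips M"
        using ef unfolding centered_flips_def by blast
      ultimately show "X \<in> (\<lambda>N. M - N) ` centered_flips M" by blast
    qed
  qed
qed

section \<open>Parity on half circles\<close>

text \<open>\<open>P\<close> splits into the half circle, its reflection through the centre, and the
  points \<open>p\<close> and \<open>- p\<close>.\<close>

lemma card_half_circle:
  assumes "p \<in> P"
  shows "card P = 2 * card (half_circle P p) + 2"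
proof -
  let ?H = "half_circle P p"
  have "p \<noteq> - p" using norm_P[OF assms] unfolding equal_neg_zero by auto
  have P: "P = (?H \<union> uminus ` ?H) \<union> {p, - p}"
  proof (intro equalityI subsetI)
    fix z assume z: "z \<in> P"
    show "z \<in> (?H \<union> uminus ` ?H) \<union> {p, - p}"
    proof (cases "cross2 p z = 0")
      case True
      then show ?thesis using cross2_eq_0_unit[of p z] norm_P z assms by auto
    next
      case False
      then consider "cross2 p z > 0" | "cross2 p (- z) > 0" by fastforce
      then show ?thesis
        using z uminus_P unfolding half_circle_def by cases (auto intro: image_eqI[of _ _ "- z"])
    qed
  qed (use assms uminus_P in \<open>auto simp: half_circle_def\<close>)
  have fin: "finite ?H" using finite_P by (simp add: half_circle_def)
  have "card P = card (?H \<union> uminus ` ?H) + card {p, - p}"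
    by (subst P, rule card_Un_disjoint) (use fin in \<open>auto simp: half_circle_def\<close>)
  also have "card (?H \<union> uminus ` ?H) = card ?H + card (uminus ` ?H)"
    by (rule card_Un_disjoint) (use fin in \<open>auto simp: half_circle_def\<close>)
  also have "card (uminus ` ?H) = card ?H"
    by (rule card_image) (auto simp: inj_on_def)
  finally show ?thesis using \<open>p \<noteq> - p\<close> by simp
qed

lemma even_card_Union:
  assumes "N \<subseteq> M"
  shows "even (card (\<Union>N))"
proof -
  have "pairwise disjnt N"
    using assms edge_disjoint unfolding pairwise_def disjnt_def by blast
  moreover have "finite e" if "e \<in> N" for e
    using card_edge[of e] assms that by (metis card.infinite subsetD zero_neq_numeral)
  ultimately have "card (\<Union>N) = sum card N" by (rule card_Union_disjoint)
  also have "\<dots> = (\<Sum>e\<in>N. 2)" using assms card_edge by (intro sum.cong) auto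
  finally show ?thesis by simp
qed

text \<open>An edge disjoint from the diameter through \<open>p\<close> has both endpoints on the same side of it.\<close>

lemma even_half_circle:
  assumes "p \<in> P" "X \<subseteq> half_circle P p"
    and "\<And>z g. z \<in> X \<Longrightarrow> g \<in> M \<Longrightarrow> z \<in> g \<Longrightarrow> g \<inter> ({p, - p} \<union> (half_circle P p - X)) = {}"
    and "\<And>z g. z \<in> X \<Longrightarrow> g \<in> M \<Longrightarrow> z \<in> g \<Longrightarrow>
           closed_segment 0 p \<inter> convex hull g = {} \<and> closed_segment 0 (- p) \<inter> convex hull g = {}"
  shows "even (card X)"
proof -
  \<comment> \<open>A partner outside \<open>X\<close> could only lie in the opposite open half
    circle, and then the edge would meet the diameter.\<close>
  have "\<Union>{g \<in> M. g \<subseteq> X} = X"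
  proof (intro equalityI subsetI)
    fix z assume z: "z \<in> X"
    then have zP: "z \<in> P" "cross2 p z > 0" using assms(2) by (auto simp: half_circle_def)
    obtain g where g: "g \<in> M" "z \<in> g" using edge_of_point zP by blast
    have "y \<in> X" if y: "y \<in> g" for y
    proof (rule ccontr)
      assume "y \<notin> X"
      then have "y \<notin> half_circle P p" "y \<noteq> p" "y \<noteq> - p"
        using assms(3)[OF z g] y by auto
      moreover have yP: "y \<in> P" using in_P g y by blast
      ultimately have "cross2 p y < 0"
        using cross2_eq_0_unit[of p y] norm_P assms(1)
        by (auto simp: half_circle_def not_less order_le_less)
      then obtain w where "w \<in> convex hull {z, y}"
        "w \<in> closed_segment 0 p \<or> w \<in> closed_segment 0 (- p)"
        using chord_meets_diameter[of p z y] norm_P zP yP assms(1) by blast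
      moreover have "convex hull {z, y} \<subseteq> convex hull g"
        using g y by (intro hull_mono) auto
      ultimately show False using assms(4)[OF z g] by blast
    qed
    then show "z \<in> \<Union>{g \<in> M. g \<subseteq> X}" using g by blast
  qed blast
  then show ?thesis using even_card_Union[of "{g \<in> M. g \<subseteq> X}"] by auto
qed

text \<open>The edge \<open>d\<close> is the whole diameter, so no other edge meets it and the half
  circle is matched within itself.\<close>

lemma diameter_parity:
  assumes "d \<in> M" "0 \<in> convex hull d" "p \<in> d"
  shows "even (card (half_circle P p))"
proof -
  have p: "p \<in> P" using in_P assms by blast
  obtain q where d: "d = {p, q}" "p \<noteq> q"
    using card_edge[OF assms(1)] assms(3) by (auto simp: card_2_iff)
  have q: "q = - p"
    using centre_notin_hull[of p q] norm_edge[OF assms(1)] assms(2) d(1) by auto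
  have hull: "closed_segment 0 p \<subseteq> convex hull d" "closed_segment 0 (- p) \<subseteq> convex hull d"
    using assms(2) unfolding d q by (simp_all add: closed_segment_subset hull_inc)
  show ?thesis
  proof (rule even_half_circle[OF p])
    fix z g assume z: "z \<in> half_circle P p" "g \<in> M" "z \<in> g"
    then have "g \<noteq> d" using d q by (auto simp: half_circle_def)
    then have "convex hull g \<inter> convex hull d = {}" using hull_disjoint z assms by blast
    then show "closed_segment 0 p \<inter> convex hull g = {} \<and> closed_segment 0 (- p) \<inter> convex hull g = {}"
      using hull by blast
    show "g \<inter> ({p, - p} \<union> (half_circle P p - half_circle P p)) = {}"
      using edge_disjoint[OF z(2) assms(1)] \<open>g \<noteq> d\<close> d q by auto
  qed simp
qed

section \<open>Matchings with an edge through the centre\<close>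

text \<open>A quadrilateral containing the centre meets \<open>d\<close>, so to be empty it must
  have \<open>d\<close> as one of its two edges.\<close>

lemma centered_pairs_diameter:
  assumes "d \<in> M" "0 \<in> convex hull d"
  shows "card (centered_pairs M) = card (visible_edges M)"
proof -
  have only: "0 \<notin> convex hull g" if "g \<in> M" "g \<noteq> d" for g
    using hull_disjoint[OF that(1) assms(1) that(2)] assms(2) by blast
  have "centered_pairs M = (\<lambda>e. {d, e}) ` visible_edges M"
  proof (intro equalityI subsetI)
    fix X assume "X \<in> centered_pairs M"
    then obtain e f where X: "X = {e, f}" and q: "empty_quad M e f" "0 \<in> convex hull (e \<union> f)"
      unfolding centered_pairs_def by blast
    have "d = e \<or> d = f" using q assms unfolding empty_quad_def by blast
    then obtain e where X: "X = {d, e}" and e: "e \<in> M" "e \<noteq> d"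
      and emp: "\<And>g. g \<in> M \<Longrightarrow> g \<noteq> d \<Longrightarrow> g \<noteq> e \<Longrightarrow> convex hull (d \<union> e) \<inter> convex hull g = {}"
    proof
      assume "d = e"
      then show ?thesis using that[of f] X q unfolding empty_quad_def by blast
    next
      assume "d = f"
      then show ?thesis
        using that[of e] X q unfolding empty_quad_def by (simp add: Un_commute insert_commute)
    qed
    \<comment> \<open>The quadrilateral contains the centre and \<open>x\<close>, hence the radius
      to \<open>x\<close>, and is empty of other edges.\<close>
    have "\<not> shadows g x" if x: "x \<in> e" "g \<in> M" "g \<noteq> e" "0 \<notin> convex hull g" for x g
    proof -
      have "0 \<in> convex hull (d \<union> e)" using assms(2) hull_mono[of d "d \<union> e"] by blast
      then have "closed_segment 0 x \<subseteq> convex hull (d \<union> e)"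
        using x by (intro closed_segment_subset) (auto simp: hull_inc)
      then show ?thesis using emp[of g] x assms(2) unfolding shadows_def by blast
    qed
    then have "e \<in> visible_edges M" using e only visible_edges_iff by blast
    then show "X \<in> (\<lambda>e. {d, e}) ` visible_edges M" using X by blast
  next
    fix X assume "X \<in> (\<lambda>e. {d, e}) ` visible_edges M"
    then obtain e where X: "X = {d, e}" and e: "e \<in> visible_edges M" by blast
    have eM: "e \<in> M" "0 \<notin> convex hull e" using e visible_edges_iff by auto
    have "convex hull (d \<union> e) \<inter> convex hull g = {}" if g: "g \<in> M" "g \<noteq> d" "g \<noteq> e" for g
    proof (rule hull_disjoint_if_not_shadowed[OF g(1) only[OF g(1,2)]])
      fix x assume x: "x \<in> d \<union> e"
      \<comment> \<open>The radius to an endpoint of \<open>d\<close> runs inside \<open>d\<close>,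
        which \<open>g\<close> does not meet.\<close>
      have "\<not> shadows g x" if "x \<in> d"
      proof -
        have "closed_segment 0 x \<subseteq> convex hull d"
          using that assms(2) by (intro closed_segment_subset) (auto simp: hull_inc)
        then show ?thesis using hull_disjoint[OF g(1) assms(1) g(2)] unfolding shadows_def by blast
      qed
      then show "norm x = 1 \<and> \<not> shadows g x"
        using x norm_edge[OF assms(1), of x] norm_edge[OF eM(1), of x] e g only[OF g(1,2)]
        unfolding visible_edges_iff by fast
    qed
    moreover have "d \<noteq> e" using assms(2) eM(2) by blast
    ultimately have "empty_quad M d e" using assms(1) eM(1) unfolding empty_quad_def by blast
    moreover have "0 \<in> convex hull (d \<union> e)" using assms(2) hull_mono[of d "d \<union> e"] by blast
    ultimately show "X \<in> centered_pairs M" using X unfolding centered_pairs_def by blast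
  qed
  moreover have "inj_on (\<lambda>e. {d, e}) (visible_edges M)"
    using assms(2) by (auto simp: inj_on_def doubleton_eq_iff visible_edges_iff)
  ultimately show ?thesis by (simp add: card_image)
qed

end

subsection \<open>Matchings without an edge through the centre\<close>

locale diameter_free_matching = circle_matching +
  assumes diameter_free: "e \<in> M \<Longrightarrow> 0 \<notin> convex hull e"
begin

lemma visible_in_M: "e \<in> visible_edges M \<Longrightarrow> e \<in> M"
  by (simp add: visible_edges_iff)

lemma finite_visible: "finite (visible_edges M)"
  using finite_M visible_in_M by (meson finite_subset subsetI)

text \<open>The edge met first on the way from the centre to \<open>z\<close> is visible.\<close>

lemma ex_visible_shadow:
  assumes "z \<in> P"
  shows "\<exists>e\<in>visible_edges M. shadows e z"
proof -
  let ?S = "{g \<in> M. shadows g z}"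
  have "\<forall>g\<in>?S. \<exists>t. 0 \<le> t \<and> t \<le> 1 \<and> t *\<^sub>R z \<in> convex hull g"
    unfolding shadows_def by (auto simp: in_segment)
  then obtain t where t: "\<And>g. g \<in> ?S \<Longrightarrow> 0 \<le> t g \<and> t g \<le> (1::real) \<and> t g *\<^sub>R z \<in> convex hull g"
    by metis
  obtain g0 where g0: "g0 \<in> M" "z \<in> g0" using edge_of_point assms by blast
  \<comment> \<open>The edge at \<open>z\<close> shadows \<open>z\<close>, so there is a first edge
    to choose.\<close>
  then have "shadows g0 z" unfolding shadows_def using hull_inc[of z g0] by auto
  then have "finite ?S" "?S \<noteq> {}" using finite_M g0 by auto
  then obtain g where gS: "g \<in> ?S" and g_min: "\<And>h. h \<in> ?S \<Longrightarrow> t g \<le> t h"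
    using ex_is_arg_min_if_finite[of ?S t] unfolding is_arg_min_linorder by blast
  have gM: "g \<in> M" "shadows g z" using gS by auto
  have "\<not> shadows h x" if x: "x \<in> g" and h: "h \<in> M" "h \<noteq> g" for x h
  proof
    assume sh: "shadows h x"
    obtain p q where pq: "h = {p, q}" and "chord p q"
      using oriented_edge[OF h(1) diameter_free[OF h(1)]] by metis
    interpret chord p q by fact
    \<comment> \<open>Since \<open>h\<close> shadows an endpoint of \<open>g\<close>, all of
      \<open>g\<close> lies beyond \<open>h\<close>, including the point where it meets the radius
      to \<open>z\<close>; so \<open>h\<close> meets that radius earlier, against the choice of
      \<open>g\<close>.\<close>
    have beyond: "1 + p \<bullet> q < t g * ((p + q) \<bullet> z)"
      using shadowed_edge_beyond[of p q g x "t g *\<^sub>R z"] \<open>chord p q\<close> h pq gM x sh t[OF gS] by auto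
    have pos: "(p + q) \<bullet> z > 0"
      using beyond inner_bounds t[OF gS] by (smt (verit) mult_nonneg_nonpos)
    then have "t g * ((p + q) \<bullet> z) \<le> (p + q) \<bullet> z"
      using t[OF gS] by (simp add: mult_left_le_one_le)
    then have "shadows h z"
      using shadows_iff_inner[OF norm_P[OF assms]] beyond pq by auto
    then have hS: "h \<in> ?S" using h by blast
    have "t h * ((p + q) \<bullet> z) = 1 + p \<bullet> q"
      using inner_on_hull[of "t h *\<^sub>R z"] t[OF hS] pq by simp
    then have "t h < t g" using beyond pos by (metis mult_less_cancel_right_pos)
    then show False using g_min[OF hS] by simp
  qed
  then have "g \<in> visible_edges M" using gM diameter_free visible_edges_iff by blast
  then show ?thesis using gM by blast
qed

section \<open>Starts and opposite edges\<close>

definition start :: "complex set \<Rightarrow> complex" where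
  "start e = (THE s. \<exists>t. e = {s, t} \<and> cross2 s t > 0)"

lemma start_eq:
  assumes "e = {s, t}" "cross2 s t > 0"
  shows "start e = s"
  unfolding start_def
proof (rule the_equality)
  show "\<exists>t. e = {s, t} \<and> cross2 s t > 0" using assms by blast
next
  fix s' assume "\<exists>t. e = {s', t} \<and> cross2 s' t > 0"
  then show "s' = s"
    using assms cross2_commute[of s t] by (auto simp: doubleton_eq_iff)
qed

lemma start_edge:
  assumes "e \<in> M"
  obtains t where "e = {start e, t}" "cross2 (start e) t > 0" "chord (start e) t"
  using oriented_edge[OF assms diameter_free[OF assms]] start_eq by metis

lemma start_in: "e \<in> M \<Longrightarrow> start e \<in> e"
  using start_edge by (metis insertI1)

text \<open>For an edge of \<open>M\<close>, existence and uniqueness come from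
  \<open>ex_visible_shadow\<close> and \<open>visible_shadows_disjoint\<close>.\<close>

definition opposite :: "complex set \<Rightarrow> complex set" where
  "opposite e = (THE f. f \<in> visible_edges M \<and> shadows f (- start e))"

lemma opposite_eq: "f \<in> visible_edges M \<Longrightarrow> shadows f (- start e) \<Longrightarrow> opposite e = f"
  unfolding opposite_def using visible_shadows_disjoint by (intro the_equality) auto

lemma opposite_visible:
  assumes "e \<in> M"
  shows "opposite e \<in> visible_edges M" "shadows (opposite e) (- start e)"
proof -
  have "- start e \<in> P" using assms start_in in_P uminus_P by blast
  then obtain f where "f \<in> visible_edges M" "shadows f (- start e)"
    using ex_visible_shadow by blast
  then show "opposite e \<in> visible_edges M" "shadows (opposite e) (- start e)"
    using opposite_eq by auto
qed

text \<open>Under the normal vector of \<open>e\<close> the point \<open>- start e\<close> has the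
  negative value \<open>- (1 + start e \<bullet> t)\<close>, while a shadow requires a positive
  one.\<close>

lemma opposite_neq:
  assumes "e \<in> M"
  shows "opposite e \<noteq> e"
proof
  assume eq: "opposite e = e"
  obtain t where e: "e = {start e, t}" and c: "chord (start e) t" using start_edge[OF assms] by metis
  interpret chord "start e" t by (rule c)
  have "shadows {start e, t} (- start e)" using opposite_visible(2)[OF assms] e eq by simp
  then have "1 + start e \<bullet> t \<le> (start e + t) \<bullet> (- start e)"
    using shadows_iff_inner[of "- start e"] norm_p by simp
  moreover have "(start e + t) \<bullet> (- start e) = - (1 + start e \<bullet> t)"
    using inner_comb[of "-1" 0] by simp
  ultimately show False using inner_bounds by linarith
qed

section \<open>Centered quadrilaterals\<close>

lemma empty_quad_visible:
  assumes "e \<in> visible_edges M" "f \<in> visible_edges M" "e \<noteq> f"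
  shows "empty_quad M e f"
proof -
  have "convex hull (e \<union> f) \<inter> convex hull g = {}" if g: "g \<in> M" "g \<noteq> e" "g \<noteq> f" for g
  proof (rule hull_disjoint_if_not_shadowed[OF g(1) diameter_free[OF g(1)]])
    fix x assume "x \<in> e \<union> f"
    then show "norm x = 1 \<and> \<not> shadows g x"
      using assms(1,2) g diameter_free[OF g(1)] norm_edge[of e x] norm_edge[of f x]
      unfolding visible_edges_iff by (metis UnE)
  qed
  then show ?thesis using assms visible_in_M unfolding empty_quad_def by blast
qed

lemma visible_if_centered_quad:
  assumes "empty_quad M e f" "0 \<in> convex hull (e \<union> f)"
  shows "e \<in> visible_edges M"
proof -
  have ef: "e \<in> M" "f \<in> M" "e \<noteq> f" using assms(1) unfolding empty_quad_def by auto
  have "\<not> shadows g x" if x: "x \<in> e" and g: "g \<in> M" "g \<noteq> e" for x g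
  proof (cases "g = f")
    case False
    \<comment> \<open>The radius to \<open>x\<close> stays inside the quadrilateral, which
      \<open>g\<close> avoids.\<close>
    have "closed_segment 0 x \<subseteq> convex hull (e \<union> f)"
      using x assms(2) by (intro closed_segment_subset) (auto simp: hull_inc)
    then show ?thesis using assms(1) g False unfolding empty_quad_def shadows_def by blast
  next
    case True
    show ?thesis
    proof
      assume sh: "shadows g x"
      obtain p q where pq: "f = {p, q}" and "chord p q"
        using oriented_edge[OF ef(2) diameter_free[OF ef(2)]] by metis
      interpret chord p q by fact
      \<comment> \<open>If \<open>f\<close> shadows an endpoint of \<open>e\<close>, the whole
        quadrilateral lies on or beyond the line of \<open>f\<close>, away from the centre.\<close>
      have "(p + q) \<bullet> y \<ge> 1 + p \<bullet> q" if y: "y \<in> e \<union> f" for y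
      proof (cases "y \<in> e")
        case in_e: True
        then show ?thesis
          using shadowed_edge_beyond[of p q e x y] \<open>chord p q\<close> ef pq x sh True hull_inc[of y e] by auto
      next
        case False
        then show ?thesis using y pq inner_on_hull[of y] hull_inc[of y f] by auto
      qed
      then have "convex hull (e \<union> f) \<subseteq> {y. (p + q) \<bullet> y \<ge> 1 + p \<bullet> q}"
        by (intro hull_minimal convex_halfspace_ge) auto
      then show False using assms(2) inner_bounds by auto
    qed
  qed
  then show ?thesis using ef diameter_free visible_edges_iff by blast
qed

text \<open>The centre is a convex combination of points \<open>x\<close> of \<open>e\<close> and
  \<open>y\<close> of \<open>f\<close>. Hence the cone over \<open>e\<close> and the reflected cone
  over \<open>f\<close> share a nonzero vector, and \<open>initial_ray_in_other_cone\<close>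
  applies.\<close>

lemma antipodal_starts_shadowed:
  assumes "e \<in> M" "f \<in> M" "0 \<in> convex hull (e \<union> f)"
  shows "shadows f (- start e) \<or> shadows e (- start f)"
proof -
  obtain t where e: "e = {start e, t}" "cross2 (start e) t > 0" and ce: "chord (start e) t"
    using start_edge[OF assms(1)] .
  obtain t' where f: "f = {start f, t'}" "cross2 (start f) t' > 0" and cf: "chord (start f) t'"
    using start_edge[OF assms(2)] .
  have "convex hull (e \<union> f) \<subseteq> convex hull (convex hull e \<union> convex hull f)"
    by (intro hull_mono) (auto intro: hull_inc)
  then have "0 \<in> convex hull (convex hull e \<union> convex hull f)" using assms(3) by blast
  moreover have "convex hull e \<noteq> {}" "convex hull f \<noteq> {}" using e(1) f(1) by auto
  ultimately obtain u v x y where uv: "0 = u *\<^sub>R x + v *\<^sub>R y" "u \<ge> 0" "v \<ge> 0" "u + v = 1"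
    and x: "x \<in> convex hull e" and y: "y \<in> convex hull f"
    using convex_hull_union_two[OF convex_convex_hull _ convex_convex_hull, of e f] by blast
  have "u \<noteq> 0" using uv y diameter_free[OF assms(2)] by auto
  have "x \<noteq> 0" using x diameter_free[OF assms(1)] by auto
  obtain a b where ab: "x = a *\<^sub>R start e + b *\<^sub>R t" "a \<ge> 0" "b \<ge> 0"
    using x by (subst (asm) e(1)) (auto simp: convex_hull_2)
  obtain a' b' where ab': "y = a' *\<^sub>R start f + b' *\<^sub>R t'" "a' \<ge> 0" "b' \<ge> 0"
    using y by (subst (asm) f(1)) (auto simp: convex_hull_2)
  have z1: "u *\<^sub>R x = (u * a) *\<^sub>R start e + (u * b) *\<^sub>R t"
    unfolding ab by (simp add: scaleR_add_right)
  have "u *\<^sub>R x = - (v *\<^sub>R y)" using uv(1) by (simp add: eq_neg_iff_add_eq_0)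
  then have z2: "u *\<^sub>R x = (v * a') *\<^sub>R (- start f) + (v * b') *\<^sub>R (- t')"
    unfolding ab' by (simp add: scaleR_add_right)
  \<comment> \<open>Reflection through the centre keeps the orientation, so \<open>- start f\<close>
    is the initial ray of the reflected cone.\<close>
  have c': "cross2 (- start f) (- t') > 0" using f(2) by simp
  have nz: "u *\<^sub>R x \<noteq> 0" using \<open>u \<noteq> 0\<close> \<open>x \<noteq> 0\<close> by simp
  consider c d where "c \<ge> 0" "d \<ge> 0" "start e = c *\<^sub>R (- start f) + d *\<^sub>R (- t')"
    | c d where "c \<ge> 0" "d \<ge> 0" "- start f = c *\<^sub>R start e + d *\<^sub>R t"
    using initial_ray_in_other_cone[OF e(2) c' z1 z2 nz] uv ab ab' by auto
  then show ?thesis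
  proof cases
    case 1
    then have "- start e = c *\<^sub>R start f + d *\<^sub>R t'" by simp
    moreover have "norm (- start e) = 1" using ce by (simp add: chord_def)
    ultimately have "shadows {start f, t'} (- start e)"
      using 1 by (intro chord.shadows_if_cone[OF cf])
    then show ?thesis using f(1) by simp
  next
    case 2
    moreover have "norm (- start f) = 1" using cf by (simp add: chord_def)
    ultimately have "shadows {start e, t} (- start f)"
      by (intro chord.shadows_if_cone[OF ce])
    then show ?thesis using e(1) by simp
  qed
qed

lemma centered_pairs_eq: "centered_pairs M = (\<lambda>e. {e, opposite e}) ` visible_edges M"
proof (intro equalityI subsetI)
  fix X assume "X \<in> centered_pairs M"
  then obtain e f where X: "X = {e, f}" and q: "empty_quad M e f" "0 \<in> convex hull (e \<union> f)"
    unfolding centered_pairs_def by blast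
  have "empty_quad M f e" "0 \<in> convex hull (f \<union> e)"
    using q by (auto simp: empty_quad_def Un_commute insert_commute)
  then have V: "e \<in> visible_edges M" "f \<in> visible_edges M"
    using visible_if_centered_quad q by blast+
  then have "opposite e = f \<or> opposite f = e"
    using antipodal_starts_shadowed[OF _ _ q(2)] visible_in_M opposite_eq by blast
  then have "X = {e, opposite e} \<or> X = {f, opposite f}"
    using X by (metis insert_commute)
  then show "X \<in> (\<lambda>e. {e, opposite e}) ` visible_edges M" using V by blast
next
  fix X assume "X \<in> (\<lambda>e. {e, opposite e}) ` visible_edges M"
  then obtain e where X: "X = {e, opposite e}" and e: "e \<in> visible_edges M" by blast
  have eM: "e \<in> M" using e visible_in_M by blast
  obtain r where r: "0 \<le> r" "r \<le> 1" and hull: "r *\<^sub>R (- start e) \<in> convex hull (opposite e)"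
    using opposite_visible(2)[OF eM] unfolding shadows_def by (auto simp: in_segment)
  \<comment> \<open>The weights balance \<open>start e\<close> against the point where the opposite
    edge meets the radius to \<open>- start e\<close>.\<close>
  have "0 = (1 - 1 / (1 + r)) *\<^sub>R start e + (1 / (1 + r)) *\<^sub>R (r *\<^sub>R (- start e))"
  proof -
    have "1 - 1 / (1 + r) = (1 / (1 + r)) * r" using r by (simp add: field_simps)
    then show ?thesis by simp
  qed
  then have "0 \<in> closed_segment (start e) (r *\<^sub>R (- start e))"
    unfolding in_segment using r by (intro exI[of _ "1 / (1 + r)"]) (simp add: field_simps)
  moreover have "start e \<in> convex hull (e \<union> opposite e)"
    using start_in[OF eM] by (simp add: hull_inc)
  moreover have "r *\<^sub>R (- start e) \<in> convex hull (e \<union> opposite e)"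
    using hull hull_mono[of "opposite e" "e \<union> opposite e"] by blast
  ultimately have "0 \<in> convex hull (e \<union> opposite e)"
    using closed_segment_subset[OF _ _ convex_convex_hull] by blast
  moreover have "empty_quad M e (opposite e)"
    using empty_quad_visible e opposite_visible[OF eM] opposite_neq[OF eM] by metis
  ultimately show "X \<in> centered_pairs M" using X unfolding centered_pairs_def by blast
qed

section \<open>Counting pairs\<close>

lemma card_centered_le_visible: "card (centered_pairs M) \<le> card (visible_edges M)"
  unfolding centered_pairs_eq by (rule card_image_le[OF finite_visible])

text \<open>Every visible edge belongs to its own pair, and a pair has at most two members.\<close>

lemma card_visible_le_centered: "card (visible_edges M) \<le> 2 * card (centered_pairs M)"
proof -
  have fin: "finite (centered_pairs M)" unfolding centered_pairs_eq using finite_visible by simp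
  have "card (visible_edges M) \<le> card (\<Union>(centered_pairs M))"
    using fin by (intro card_mono) (auto simp: centered_pairs_eq)
  also have "\<dots> \<le> sum card (centered_pairs M)" by (rule card_Union_le_sum_card)
  also have "\<dots> \<le> (\<Sum>X\<in>centered_pairs M. 2)"
    by (intro sum_mono) (auto simp: centered_pairs_eq card_insert_if)
  finally show ?thesis by simp
qed

text \<open>Every pair consists of two distinct visible edges, so here it is the set of all visible
  edges. If there is no pair, the lower bound leaves no visible edge.\<close>

lemma card_visible_eq_centered:
  assumes "card (visible_edges M) \<le> 2"
  shows "card (visible_edges M) = 2 * card (centered_pairs M)"
proof -
  have "X = visible_edges M \<and> card X = 2" if XC: "X \<in> centered_pairs M" for X
  proof -
    obtain e where e: "e \<in> visible_edges M" and X: "X = {e, opposite e}"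
      using XC unfolding centered_pairs_eq by blast
    have eM: "e \<in> M" using e visible_in_M by blast
    have card: "card X = 2" unfolding X using opposite_neq[OF eM] by auto
    moreover have "X \<subseteq> visible_edges M" using e opposite_visible(1)[OF eM] X by blast
    ultimately show ?thesis using card_seteq[OF finite_visible] assms by metis
  qed
  then have "centered_pairs M \<subseteq> {visible_edges M} \<and>
      (centered_pairs M \<noteq> {} \<longrightarrow> card (visible_edges M) = 2)"
    by blast
  then have "centered_pairs M = {} \<or>
      centered_pairs M = {visible_edges M} \<and> card (visible_edges M) = 2"
    by blast
  then show ?thesis using card_visible_le_centered by auto
qed

text \<open>The antipode of each start lies in the cone over the other edge, so it is not clockwise
  of that edge's start. The two inequalities squeeze \<open>cross2 (start e) (start f)\<close> to
  0.\<close>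

lemma antipodal_starts_if_same_pair:
  assumes "e \<in> M" "f \<in> M" "e \<noteq> f" "{e, opposite e} = {f, opposite f}"
  shows "start f = - start e"
proof -
  have opp: "opposite e = f" "opposite f = e" using assms by (auto simp: doubleton_eq_iff)
  obtain t where e: "e = {start e, t}" "cross2 (start e) t > 0" and ce: "chord (start e) t"
    using start_edge[OF assms(1)] .
  obtain t' where f: "f = {start f, t'}" "cross2 (start f) t' > 0" and cf: "chord (start f) t'"
    using start_edge[OF assms(2)] .
  have "shadows {start f, t'} (- start e)"
    using opposite_visible(2)[OF assms(1)] opp f(1) by simp
  then obtain a b where ab: "- start e = a *\<^sub>R start f + b *\<^sub>R t'" "a \<ge> 0" "b \<ge> 0"
    using chord.shadows_imp_cone[OF cf] by metis
  have "shadows {start e, t} (- start f)"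
    using opposite_visible(2)[OF assms(2)] opp e(1) by simp
  then obtain a' b' where ab': "- start f = a' *\<^sub>R start e + b' *\<^sub>R t" "a' \<ge> 0" "b' \<ge> 0"
    using chord.shadows_imp_cone[OF ce] by metis
  have "cross2 (start f) (- start e) = b * cross2 (start f) t'" unfolding ab(1) by simp
  then have "cross2 (start f) (- start e) \<ge> 0" using ab(3) f(2) by simp
  moreover have "cross2 (start e) (- start f) = b' * cross2 (start e) t" unfolding ab'(1) by simp
  then have "cross2 (start e) (- start f) \<ge> 0" using ab'(3) e(2) by simp
  ultimately have "cross2 (start e) (start f) = 0"
    using cross2_commute[of "start e" "start f"] by simp
  moreover have "start e \<noteq> start f"
    using edge_disjoint[OF assms(1,2)] start_in assms by metis
  ultimately show ?thesis
    using cross2_eq_0_unit[of "start e" "start f"] ce cf by (auto simp: chord_def)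
qed

lemma card_centered_eq_visible:
  assumes "\<And>e f. e \<in> visible_edges M \<Longrightarrow> f \<in> visible_edges M \<Longrightarrow> start f \<noteq> - start e"
  shows "card (centered_pairs M) = card (visible_edges M)"
proof -
  have "inj_on (\<lambda>e. {e, opposite e}) (visible_edges M)"
    using assms antipodal_starts_if_same_pair visible_in_M by (intro inj_onI) blast
  then show ?thesis unfolding centered_pairs_eq by (rule card_image)
qed

lemma antipodal_starts_parity:
  assumes "e \<in> visible_edges M" "f \<in> visible_edges M" "start f = - start e"
  shows "odd (card (half_circle P (start e)))"
proof -
  let ?H = "half_circle P (start e)"
  have eM: "e \<in> M" and fM: "f \<in> M" using assms visible_in_M by auto
  obtain t where e: "e = {start e, t}" "cross2 (start e) t > 0" using start_edge[OF eM] .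
  obtain t' where "f = {start f, t'}" "cross2 (start f) t' > 0" using start_edge[OF fM] .
  \<comment> \<open>The sign puts the partner of \<open>- start e\<close> on the other half circle,
    so only \<open>t\<close> has to be removed from \<open>?H\<close>.\<close>
  then have f: "f = {- start e, t'}" "cross2 (start e) t' < 0" using assms(3) by auto
  have "start e \<in> P" using start_in in_P eM by blast
  have "t \<in> P" using e(1) in_P[OF eM, of t] by blast
  then have tH: "t \<in> ?H" using e by (simp add: half_circle_def)
  have "even (card (?H - {t}))"
  proof (rule even_half_circle[OF \<open>start e \<in> P\<close>])
    fix z g assume z: "z \<in> ?H - {t}" and g: "g \<in> M" "z \<in> g"
    have "z \<noteq> start e" "z \<noteq> - start e" "z \<noteq> t" "z \<noteq> t'"
      using z f(2) by (auto simp: half_circle_def)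
    then have ge: "g \<noteq> e" and gf: "g \<noteq> f" using g(2) e(1) f(1) by blast+
    \<comment> \<open>Visibility of \<open>e\<close> clears one radius of the diameter, visibility
      of \<open>f\<close> the other.\<close>
    have "\<not> shadows g (start e)"
      using assms(1) g(1) ge start_in[OF eM] diameter_free visible_edges_iff by metis
    moreover have "\<not> shadows g (- start e)"
      using assms(2) g(1) gf start_in[OF fM] assms(3) diameter_free visible_edges_iff by metis
    ultimately show "closed_segment 0 (start e) \<inter> convex hull g = {} \<and>
        closed_segment 0 (- start e) \<inter> convex hull g = {}"
      by (simp add: shadows_def)
    have "x \<notin> g" if "x \<in> e \<union> f" for x
      using edge_disjoint[OF g(1) eM, of x] edge_disjoint[OF g(1) fM, of x] ge gf that by blast
    then have "start e \<notin> g" "- start e \<notin> g" "t \<notin> g" using e(1) f(1) by blast+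
    then show "g \<inter> ({start e, - start e} \<union> (?H - (?H - {t}))) = {}" by blast
  qed blast
  moreover have "finite ?H" using finite_P by (simp add: half_circle_def)
  ultimately show ?thesis
    using tH by (metis card_Suc_Diff1 even_Suc)
qed

end

subsection \<open>Equidistant points\<close>

text \<open>Allowing every index lets \<open>k + n\<close> denote the antipode.\<close>

definition circle_point :: "nat \<Rightarrow> nat \<Rightarrow> complex" where
  "circle_point n k = cis (2 * pi * real k / real (2 * n))"

lemma circle_points_eq: "circle_points n = circle_point n ` {..<2 * n}"
  by (simp add: circle_points_def circle_point_def)

lemma norm_circle_point [simp]: "norm (circle_point n k) = 1"
  by (simp add: circle_point_def)

lemma inj_on_circle_point: "n \<ge> 1 \<Longrightarrow> inj_on (circle_point n) {..<2 * n}"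
  using Complex.bij_betw_roots_unity[of "2 * n"] unfolding bij_betw_def circle_point_def by simp

text \<open>As roots of unity of even order the points are closed under negation.\<close>

lemma circle_points_roots: "n \<ge> 1 \<Longrightarrow> circle_points n = {z. z ^ (2 * n) = 1}"
  using Complex.bij_betw_roots_unity[of "2 * n"] unfolding bij_betw_def circle_points_def by simp

lemma card_circle_points: "n \<ge> 1 \<Longrightarrow> card (circle_points n) = 2 * n"
  unfolding circle_points_eq by (simp add: card_image inj_on_circle_point)

lemma circle_point_add: "n \<ge> 1 \<Longrightarrow> circle_point n (k + n) = - circle_point n k"
  by (simp add: circle_point_def add_divide_distrib distrib_left cis_mult[symmetric])

lemma circle_point_antipodal:
  assumes "n \<ge> 1" "j < 2 * n" "k < 2 * n" "circle_point n k = - circle_point n j"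
  shows "k = j + n \<or> j = k + n"
proof (cases "j < n")
  case True
  then have "circle_point n k = circle_point n (j + n)" using assms circle_point_add by simp
  then show ?thesis using inj_onD[OF inj_on_circle_point[OF assms(1)]] assms True by simp
next
  case False
  then have "circle_point n k = circle_point n (j - n)"
    using assms circle_point_add[of n "j - n"] by simp
  then show ?thesis using inj_onD[OF inj_on_circle_point[OF assms(1)]] assms False by fastforce
qed

lemma nc_matchings_iff:
  assumes "n \<ge> 1"
  shows "M \<in> nc_matchings n \<longleftrightarrow> circle_matching (circle_points n) M"
proof
  assume M: "M \<in> nc_matchings n"
  show "circle_matching (circle_points n) M"
  proof
    show "norm z = 1" if "z \<in> circle_points n" for z
      using that by (auto simp: circle_points_def)
    show "- z \<in> circle_points n" if "z \<in> circle_points n" for z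
      using that by (simp add: circle_points_roots[OF assms])
  qed (use M in \<open>auto simp: nc_matchings_def pairwise_def circle_points_def\<close>)
next
  assume "circle_matching (circle_points n) M"
  then interpret circle_matching "circle_points n" M .
  show "M \<in> nc_matchings n"
    using partition card_edge hull_disjoint by (auto simp: nc_matchings_def pairwise_def)
qed

section \<open>The parity of \<open>n\<close>\<close>

text \<open>The half circle holds \<open>n - 1\<close> points, an odd number, whereas an edge
  through the centre would make this number even.\<close>

lemma even_imp_diameter_free:
  assumes "n \<ge> 1" "even n" "M \<in> nc_matchings n"
  shows "diameter_free_matching (circle_points n) M"
proof -
  interpret circle_matching "circle_points n" M using assms nc_matchings_iff by blast
  show ?thesis
  proof
    fix d assume d: "d \<in> M"
    then obtain p where p: "p \<in> d" using card_edge by fastforce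
    have "card (half_circle (circle_points n) p) = n - 1"
      using card_half_circle[of p] in_P[OF d p] card_circle_points[OF assms(1)] by simp
    then have "odd (card (half_circle (circle_points n) p))" using assms by simp
    then show "0 \<notin> convex hull d" using diameter_parity[OF d _ p] by blast
  qed
qed

lemma odd_card_centered_flips:
  assumes "n \<ge> 1" "odd n" "M \<in> nc_matchings n"
  shows "card (centered_flips M) = card (visible_edges M)"
proof -
  interpret circle_matching "circle_points n" M using assms nc_matchings_iff by blast
  show ?thesis
  proof (cases "\<exists>d\<in>M. 0 \<in> convex hull d")
    case True
    then show ?thesis using centered_pairs_diameter card_centered_flips by auto
  next
    case False
    then interpret diameter_free_matching "circle_points n" M by unfold_locales blast
    have "start f \<noteq> - start e" if "e \<in> visible_edges M" "f \<in> visible_edges M" for e f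
    proof
      assume "start f = - start e"
      then have "odd (card (half_circle (circle_points n) (start e)))"
        using antipodal_starts_parity that by blast
      moreover have "start e \<in> circle_points n" using that visible_in_M start_in in_P by blast
      then have "card (half_circle (circle_points n) (start e)) = n - 1"
        using card_half_circle[of "start e"] card_circle_points[OF assms(1)] by simp
      ultimately show False using assms(2) by simp
    qed
    then show ?thesis using card_centered_eq_visible card_centered_flips by simp
  qed
qed

section \<open>Circle points relative to a chord\<close>

lemma cross2_circle_point:
  "cross2 (circle_point n a) (circle_point n b) = sin (pi * (real b - real a) / real n)"
proof -
  have "pi * (real b - real a) / real n = pi * real b / real n - pi * real a / real n"
    by (simp add: right_diff_distrib diff_divide_distrib)
  then show ?thesis by (simp add: cross2_def circle_point_def sin_diff)
qed

lemma cross2_circle_point_pos: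
  assumes "a < b" "b - a < n"
  shows "cross2 (circle_point n a) (circle_point n b) > 0"
  unfolding cross2_circle_point
proof (rule sin_gt_zero)
  show "0 < pi * (real b - real a) / real n" using assms by simp
  have "(real b - real a) / real n < 1" using assms by (simp add: field_simps)
  then have "pi * ((real b - real a) / real n) < pi * 1" by (intro mult_strict_left_mono) auto
  then show "pi * (real b - real a) / real n < pi" by simp
qed

lemma inner_circle_point:
  "circle_point n a \<bullet> circle_point n b = cos (pi * (real b - real a) / real n)"
proof -
  have "pi * (real b - real a) / real n = pi * real b / real n - pi * real a / real n"
    by (simp add: right_diff_distrib diff_divide_distrib)
  then show ?thesis by (simp add: inner_complex_def circle_point_def cos_diff mult.commute)
qed

text \<open>With \<open>\<alpha>\<close> and \<open>\<beta>\<close> half the angles from \<open>a\<close> to \<open>k\<close> and from \<open>k\<close> to \<open>b\<close>, this is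
  \<open>cos 2\<alpha> + cos 2\<beta> - 1 - cos (2\<alpha> + 2\<beta>) = 4 sin \<alpha> sin \<beta> cos (\<alpha> + \<beta>)\<close>.\<close>

lemma circle_point_side:
  fixes n a b k :: nat
  defines "p \<equiv> circle_point n a" and "q \<equiv> circle_point n b"
  shows "(p + q) \<bullet> circle_point n k - (1 + p \<bullet> q) =
    4 * sin (pi * (real k - real a) / real n / 2) * sin (pi * (real b - real k) / real n / 2) *
      cos (pi * (real b - real a) / real n / 2)"
proof -
  define \<alpha> where "\<alpha> = pi * (real k - real a) / real n / 2"
  define \<beta> where "\<beta> = pi * (real b - real k) / real n / 2"
  have sum: "pi * (real b - real a) / real n / 2 = \<alpha> + \<beta>"
    unfolding \<alpha>_def \<beta>_def add_divide_distrib[symmetric] distrib_left[symmetric] by simp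
  have "p \<bullet> circle_point n k = cos (2 * \<alpha>)"
    unfolding p_def inner_circle_point \<alpha>_def by simp
  moreover have "q \<bullet> circle_point n k = cos (2 * \<beta>)"
    using inner_circle_point[of n k b] unfolding q_def \<beta>_def by (simp add: inner_commute)
  moreover have "p \<bullet> q = cos (2 * (\<alpha> + \<beta>))"
    unfolding p_def q_def inner_circle_point sum[symmetric] by simp
  moreover have "cos (2 * \<alpha>) + cos (2 * \<beta>) - (1 + cos (2 * (\<alpha> + \<beta>))) =
      4 * sin \<alpha> * sin \<beta> * cos (\<alpha> + \<beta>)"
    unfolding cos_double cos_add sin_add
    using sin_cos_squared_add[of \<alpha>] sin_cos_squared_add[of \<beta>] by algebra
  ultimately show ?thesis
    unfolding inner_add_left sum \<alpha>_def[symmetric] \<beta>_def[symmetric] by simp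
qed

lemma half_angle_bounds:
  assumes "0 < x" "x < 2 * real n"
  shows "0 < pi * x / real n / 2 \<and> pi * x / real n / 2 < pi"
  using assms by (simp add: field_simps)

lemma half_angle_cos_pos:
  assumes "a < b" "b - a < n"
  shows "cos (pi * (real b - real a) / real n / 2) > 0"
proof (rule cos_gt_zero_pi)
  have "(real b - real a) / real n < 1" using assms by (simp add: field_simps)
  then have "pi * ((real b - real a) / real n) < pi * 1" by (intro mult_strict_left_mono) auto
  then show "pi * (real b - real a) / real n / 2 < pi / 2" by simp
  have "0 \<le> pi * (real b - real a) / real n / 2" using assms by simp
  then show "- (pi / 2) < pi * (real b - real a) / real n / 2"
    using pi_gt_zero by linarith
qed

text \<open>All three trigonometric factors in \<open>circle_point_side\<close> are
  positive.\<close>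

lemma circle_point_inside:
  assumes "a < k" "k < b" "b - a < n"
  defines "p \<equiv> circle_point n a" and "q \<equiv> circle_point n b"
  shows "1 + p \<bullet> q < (p + q) \<bullet> circle_point n k"
proof -
  have "real k - real a < real n" "real b - real k < real n" using assms by linarith+
  then have "0 < sin (pi * (real k - real a) / real n / 2)" "0 < sin (pi * (real b - real k) / real n / 2)"
    using assms half_angle_bounds[of "real k - real a" n] half_angle_bounds[of "real b - real k" n]
    by (auto intro!: sin_gt_zero)
  moreover have "cos (pi * (real b - real a) / real n / 2) > 0"
    using assms by (intro half_angle_cos_pos) auto
  ultimately have "0 < (p + q) \<bullet> circle_point n k - (1 + p \<bullet> q)"
    unfolding p_def q_def circle_point_side by simp
  then show ?thesis by simp
qed

text \<open>As \<open>k\<close> is past \<open>b\<close>, only the second sine in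
  \<open>circle_point_side\<close> is negative; \<open>k < 2 * n\<close> keeps the half angles below
  \<open>pi\<close>.\<close>

lemma circle_point_outside:
  assumes "a < b" "b < k" "k < 2 * n" "b - a < n"
  defines "p \<equiv> circle_point n a" and "q \<equiv> circle_point n b"
  shows "(p + q) \<bullet> circle_point n k < 1 + p \<bullet> q"
proof -
  have "real k - real a < 2 * real n" "real k - real b < 2 * real n" using assms by linarith+
  then have "0 < sin (pi * (real k - real a) / real n / 2)" "0 < sin (pi * (real k - real b) / real n / 2)"
    using assms half_angle_bounds[of "real k - real a" n] half_angle_bounds[of "real k - real b" n]
    by (auto intro!: sin_gt_zero)
  moreover have "sin (pi * (real b - real k) / real n / 2) = - sin (pi * (real k - real b) / real n / 2)"
    unfolding sin_minus[symmetric] minus_divide_left mult_minus_right[symmetric] by simp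
  moreover have "cos (pi * (real b - real a) / real n / 2) > 0"
    using assms by (intro half_angle_cos_pos) auto
  ultimately have "(p + q) \<bullet> circle_point n k - (1 + p \<bullet> q) < 0"
    unfolding p_def q_def circle_point_side by simp
  then show ?thesis by simp
qed

lemma chord_circle_point: "a < b \<Longrightarrow> b - a < n \<Longrightarrow> chord (circle_point n a) (circle_point n b)"
  by (intro chord_if_cross2_pos cross2_circle_point_pos) simp_all

section \<open>Matchings from index involutions\<close>

text \<open>A matching of the points is described by the involution \<open>m\<close> it induces on their indices.\<close>

locale index_matching =
  fixes n :: nat and m :: "nat \<Rightarrow> nat"
  assumes n_pos: "n \<ge> 1"
    and m_less: "k < 2 * n \<Longrightarrow> m k < 2 * n"
    and m_neq: "k < 2 * n \<Longrightarrow> m k \<noteq> k"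
    and m_m: "k < 2 * n \<Longrightarrow> m (m k) = k"
    and m_short: "k < 2 * n \<Longrightarrow> k < m k \<Longrightarrow> m k - k < n"
    and m_noncrossing: "a < 2 * n \<Longrightarrow> c < 2 * n \<Longrightarrow> a < m a \<Longrightarrow> c < m c \<Longrightarrow> a < c \<Longrightarrow>
      m a < c \<or> m c < m a"
begin

definition edge :: "nat \<Rightarrow> complex set" where
  "edge k = {circle_point n k, circle_point n (m k)}"

text \<open>Each edge is listed from its smaller index, which is its start by
  \<open>m_short\<close>.\<close>

definition edges :: "complex set set" where
  "edges = edge ` {k. k < 2 * n \<and> k < m k}"

lemma edge_m: "k < 2 * n \<Longrightarrow> edge (m k) = edge k"
  by (simp add: edge_def m_m insert_commute)

lemma edge_in_edges:
  assumes "k < 2 * n"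
  shows "edge k \<in> edges"
proof (cases "k < m k")
  case True
  then show ?thesis using assms by (auto simp: edges_def)
next
  case False
  then have "m k < m (m k)" using m_neq[OF assms] m_m[OF assms] by simp
  then have "edge (m k) \<in> edges" using m_less[OF assms] by (auto simp: edges_def)
  then show ?thesis using edge_m assms by simp
qed

text \<open>The line of \<open>edge a\<close> has both endpoints of \<open>edge c\<close> strictly
  on the centre's side if the edges are side by side, and strictly beyond it if they are
  nested.\<close>

lemma edge_hulls_disjoint:
  assumes "a < 2 * n" "c < 2 * n" "a < m a" "c < m c" "a < c"
  shows "convex hull (edge a) \<inter> convex hull (edge c) = {}"
proof -
  let ?p = "circle_point n a" and ?q = "circle_point n (m a)"
  interpret chord ?p ?q using assms m_short by (intro chord_circle_point) auto
  consider "m a < c" | "m c < m a" using m_noncrossing assms by blast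
  then show ?thesis
  proof cases
    case 1
    have "(?p + ?q) \<bullet> x < 1 + ?p \<bullet> ?q" if "x \<in> edge c" for x
      using that 1 assms m_less m_short circle_point_outside[of a "m a" _ n]
      by (auto simp: edge_def)
    then have "convex hull (edge c) \<subseteq> {x. (?p + ?q) \<bullet> x < 1 + ?p \<bullet> ?q}"
      by (intro hull_minimal convex_halfspace_lt) blast
    then show ?thesis using inner_on_hull unfolding edge_def by fastforce
  next
    case 2
    have "(?p + ?q) \<bullet> x > 1 + ?p \<bullet> ?q" if "x \<in> edge c" for x
      using that 2 assms m_less m_short circle_point_inside[of a _ "m a" n]
      by (auto simp: edge_def)
    then have "convex hull (edge c) \<subseteq> {x. (?p + ?q) \<bullet> x > 1 + ?p \<bullet> ?q}"
      by (intro hull_minimal convex_halfspace_gt) blast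
    then show ?thesis using inner_on_hull unfolding edge_def by fastforce
  qed
qed

lemma edges_disjoint:
  assumes "e \<in> edges" "f \<in> edges" "e \<noteq> f"
  shows "convex hull e \<inter> convex hull f = {}"
proof -
  obtain a c where "e = edge a" "f = edge c" "a < 2 * n" "c < 2 * n" "a < m a" "c < m c"
    using assms(1,2) unfolding edges_def by blast
  then show ?thesis
    using edge_hulls_disjoint[of a c] edge_hulls_disjoint[of c a] assms(3)
    by (metis inf_commute nat_neq_iff)
qed

lemma edges_nc_matching: "edges \<in> nc_matchings n"
proof -
  have "partition_on (circle_points n) edges"
  proof (rule partition_onI)
    show "\<Union>edges = circle_points n"
    proof
      show "\<Union>edges \<subseteq> circle_points n"
        using m_less by (auto simp: edges_def edge_def circle_points_eq)
      show "circle_points n \<subseteq> \<Union>edges"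
      proof
        fix z assume "z \<in> circle_points n"
        then obtain k where k: "k < 2 * n" "z = circle_point n k" by (auto simp: circle_points_eq)
        then have "z \<in> edge k" by (simp add: edge_def)
        then show "z \<in> \<Union>edges" using edge_in_edges[OF k(1)] by blast
      qed
    qed
    show "disjnt e f" if "e \<in> edges" "f \<in> edges" "e \<noteq> f" for e f
      using edges_disjoint[OF that] hull_subset[of e convex] hull_subset[of f convex]
      unfolding disjnt_def by blast
    show "{} \<notin> edges" by (auto simp: edges_def edge_def)
  qed
  moreover have "card e = 2" if e: "e \<in> edges" for e
  proof -
    obtain k where k: "e = edge k" "k < 2 * n" using e by (auto simp: edges_def)
    then have "circle_point n k \<noteq> circle_point n (m k)"
      using inj_onD[OF inj_on_circle_point[OF n_pos], of k "m k"] m_less[OF k(2)] m_neq[OF k(2)]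
      by auto
    then show ?thesis using k by (simp add: edge_def)
  qed
  ultimately show ?thesis
    using edges_disjoint unfolding nc_matchings_def pairwise_def by blast
qed

text \<open>An edge starting earlier and ending later would shadow
  \<open>circle_point n a\<close>.\<close>

lemma visible_outermost:
  assumes "e \<in> visible_edges edges"
  obtains a where "e = edge a" "a < 2 * n" "a < m a"
    "\<And>c. c < a \<Longrightarrow> m c \<le> m a"
proof -
  interpret circle_matching "circle_points n" edges
    using edges_nc_matching nc_matchings_iff n_pos by blast
  obtain a where a: "e = edge a" "a < 2 * n" "a < m a"
    using visible_edges_iff[of e] assms by (auto simp: edges_def)
  have "m c \<le> m a" if c: "c < a" for c
  proof (rule ccontr)
    assume "\<not> m c \<le> m a"
    then have mc: "m a < m c" "c < 2 * n" "c < m c" using a c by auto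
    let ?p = "circle_point n c" and ?q = "circle_point n (m c)"
    have short: "m c - c < n" using mc m_short by blast
    interpret chord ?p ?q using mc short by (intro chord_circle_point) auto
    have "shadows (edge c) (circle_point n a)"
      using circle_point_inside[of c a "m c" n] short a mc c
      unfolding edge_def by (intro shadows_if_inner_le) auto
    moreover have "edge c \<noteq> e"
    proof -
      have "circle_point n c \<notin> e"
        using inj_onD[OF inj_on_circle_point[OF n_pos], of c a]
          inj_onD[OF inj_on_circle_point[OF n_pos], of c "m a"] a mc c m_less[OF a(2)]
        by (auto simp: edge_def)
      then show ?thesis by (auto simp: edge_def)
    qed
    moreover have "circle_point n a \<in> e" using a by (simp add: edge_def)
    moreover have "0 \<notin> convex hull (edge c)" using centre by (simp add: edge_def)
    ultimately show False
      using assms edge_in_edges[OF mc(2)] unfolding visible_edges_iff by blast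
  qed
  then show ?thesis using that a by blast
qed

end

section \<open>Tight examples\<close>

text \<open>Two bundles of nested edges on \<open>n\<close> consecutive points each: only the two
  outermost edges can be visible, so \<open>card_visible_eq_centered\<close> applies.\<close>

lemma ex_tight_lower:
  assumes "even n" "n \<ge> 2"
  shows "\<exists>M\<in>nc_matchings n. card (visible_edges M) = 2 * card (centered_flips M)"
proof -
  \<comment> \<open>Both blocks are reversed; as \<open>n\<close> is even, no index is
    fixed.\<close>
  define m where "m k = (if k < n then n - 1 - k else 3 * n - 1 - k)" for k
  interpret index_matching n m
    using assms by unfold_locales (auto simp: m_def split: if_splits; presburger)+
  interpret diameter_free_matching "circle_points n" edges
    using assms edges_nc_matching even_imp_diameter_free by simp
  have "visible_edges edges \<subseteq> {edge 0, edge n}"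
  proof
    fix e assume "e \<in> visible_edges edges"
    then obtain a where a: "e = edge a" "a < 2 * n" "a < m a" and out: "\<And>c. c < a \<Longrightarrow> m c \<le> m a"
      using visible_outermost by metis
    have "a = 0 \<or> a = n"
    proof (rule ccontr)
      assume "\<not> (a = 0 \<or> a = n)"
      then consider "0 < a" "a < n" | "n < a" by linarith
      then show False
        using out[of 0] out[of n] a(2,3) by cases (simp_all add: m_def; linarith)+
    qed
    then show "e \<in> {edge 0, edge n}" using a by auto
  qed
  then have "card (visible_edges edges) \<le> card {edge 0, edge n}" by (intro card_mono) auto
  also have "\<dots> \<le> 2" by (simp add: card_insert_if)
  finally show ?thesis
    using card_visible_eq_centered card_centered_flips edges_nc_matching by metis
qed

text \<open>The witness consists of three bundles of nested edges on \<open>n - 2\<close>, \<open>n - 2\<close> and \<open>4\<close> consecutive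
  points; their outermost edges start at \<open>0\<close>, \<open>n - 2\<close> and \<open>2 n - 4\<close>, no two of which differ by \<open>n\<close>.\<close>

lemma ex_tight_upper:
  assumes "even n" "n \<ge> 6"
  shows "\<exists>M\<in>nc_matchings n. card (centered_flips M) = card (visible_edges M)"
proof -
  define m where "m k = (if k < n - 2 then n - 3 - k
    else if k < 2 * n - 4 then 3 * n - 7 - k else 4 * n - 5 - k)" for k
  interpret index_matching n m
    using assms by unfold_locales (auto simp: m_def split: if_splits; presburger)+
  interpret diameter_free_matching "circle_points n" edges
    using assms edges_nc_matching even_imp_diameter_free by simp
  have starts: "\<exists>a\<in>{0, n - 2, 2 * n - 4}. start e = circle_point n a" if e: "e \<in> visible_edges edges" for e
  proof -
    obtain a where a: "e = edge a" "a < 2 * n" "a < m a" and out: "\<And>c. c < a \<Longrightarrow> m c \<le> m a"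
      using visible_outermost[OF e] by metis
    have "a = 0 \<or> a = n - 2 \<or> a = 2 * n - 4"
    proof (rule ccontr)
      assume "\<not> (a = 0 \<or> a = n - 2 \<or> a = 2 * n - 4)"
      then consider "0 < a" "a < n - 2" | "n - 2 < a" "a < 2 * n - 4" | "2 * n - 4 < a" by linarith
      then show False
      proof cases
        case 1
        then have "m a < m 0" using a(3) assms by (simp add: m_def)
        then show False using out[of 0] 1 by simp
      next
        case 2
        then have "m a < m (n - 2)" using a(3) assms by (simp add: m_def)
        then show False using out[of "n - 2"] 2 by simp
      next
        case 3
        then have "m a = 4 * n - 5 - a" using assms by (simp add: m_def)
        moreover have "m (2 * n - 4) = 2 * n - 1" using assms by (simp add: m_def)
        ultimately have "m a < m (2 * n - 4)" using 3 assms by linarith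
        then show False using out[of "2 * n - 4"] 3 by simp
      qed
    qed
    moreover have "start e = circle_point n a"
      using a m_short by (intro start_eq[of _ _ "circle_point n (m a)"] cross2_circle_point_pos)
        (auto simp: edge_def)
    ultimately show ?thesis by blast
  qed
  have "start f \<noteq> - start e" if e: "e \<in> visible_edges edges" and f: "f \<in> visible_edges edges" for e f
  proof
    assume anti: "start f = - start e"
    obtain a where a: "a \<in> {0, n - 2, 2 * n - 4}" "start e = circle_point n a"
      using starts[OF e] by blast
    obtain b where b: "b \<in> {0, n - 2, 2 * n - 4}" "start f = circle_point n b"
      using starts[OF f] by blast
    have "a < 2 * n" "b < 2 * n" using a(1) b(1) assms by auto
    then have "b = a + n \<or> a = b + n"
      using circle_point_antipodal[of n a b] anti a(2) b(2) assms by simp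
    \<comment> \<open>The starts differ by 0, \<open>n - 2\<close> or \<open>2 * n - 4\<close>; the
      last equals \<open>n\<close> only for \<open>n = 4\<close>.\<close>
    then show False using a(1) b(1) assms by auto
  qed
  then have "card (centered_pairs edges) = card (visible_edges edges)"
    by (rule card_centered_eq_visible)
  then show ?thesis using card_centered_flips edges_nc_matching by metis
qed

theorem theorem3:
  fixes n :: nat
  assumes "n \<ge> 2"
  shows "(odd n \<longrightarrow>
            (\<forall>M\<in>nc_matchings n. card (centered_flips M) = card (visible_edges M))) \<and>
         (even n \<longrightarrow>
            (\<forall>M\<in>nc_matchings n.
               card (centered_flips M) \<le> card (visible_edges M) \<and>
               real (card (centered_flips M)) \<ge> real (card (visible_edges M)) / 2) \<and>
            (n \<ge> 6 \<longrightarrow>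
               (\<exists>M\<in>nc_matchings n. card (centered_flips M) = card (visible_edges M))) \<and>
            (\<exists>M\<in>nc_matchings n.
               real (card (centered_flips M)) = real (card (visible_edges M)) / 2))"
proof -
  have n: "n \<ge> 1" using assms by simp
  have bounds: "card (centered_flips M) \<le> card (visible_edges M) \<and>
      real (card (centered_flips M)) \<ge> real (card (visible_edges M)) / 2"
    if "even n" "M \<in> nc_matchings n" for M
  proof -
    interpret diameter_free_matching "circle_points n" M
      using even_imp_diameter_free n that by blast
    show ?thesis
      using card_centered_le_visible card_visible_le_centered card_centered_flips by simp
  qed
  have "\<exists>M\<in>nc_matchings n. real (card (centered_flips M)) = real (card (visible_edges M)) / 2"
    if even: "even n"
  proof -
    obtain M where "M \<in> nc_matchings n" "card (visible_edges M) = 2 * card (centered_flips M)"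
      using ex_tight_lower[OF even assms] by blast
    then show ?thesis by (intro bexI[of _ M]) simp_all
  qed
  then show ?thesis using odd_card_centered_flips[OF n] bounds ex_tight_upper by blast
qed

end
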